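(* Assume the standing assumption, the strong pseudomonotonicity assumption and the state-Lipschitz assumption stated in the context. Then $$\|u_{x_1}(t)-u_{x_2}(t)\|\le L\|x_1-x_2\|\quad\text{for all } t\in[0,T],\ x_1,x_2\in H,\qquad\text{where } L:=\frac{\alpha_h\|P^{-1}\|}{\gamma}.$$
   Context: Let $H$ be a separable real Hilbert space with inner product $\langle\cdot,\cdot\rangle$ and norm $\|\cdot\|$, and let $T>0$. A mapping $G:[0,T]\times X\to H$ ($X$ a separable metric space) is Carathéodory if $t\mapsto G(t,z)$ is strongly measurable for every $z\in X$, and $z\mapsto G(t,z)$ is continuous for almost every $t\in[0,T]$. Standing assumption: (i) $A:D(A)\subset H\to H$ is the infinitesimal generator of a strongly continuous semigroup $\{e^{At}\}_{t\ge0}$ on $H$; (ii) $P:H\to H$ is linear, bounded, self-adjoint and coercive (so $P$ is invertible with bounded inverse and $P^{-1}$ is strongly monotone); (iii) $K:[0,T]\rightrightarrows H$ is a set-valued mapping with nonempty, closed, convex values; (iv) $f,h:[0,T]\times H\times H\to H$ are Carathéodory mappings (with $X=H\times H$), and $t\mapsto f(t,0,0)$ belongs to $L^1(0,T;H)$. For $t\in[0,T]$, $x\in H$ define $F_{t,x}:H\to H$ by $F_{t,x}(y):=P^{-1}y-h(t,x,P^{-1}y)$. An operator $F:H\to H$ is strongly pseudomonotone on $C\subset H$ with modulus $m>0$ if for all $y,z\in C$: $\langle F(y),z-y\rangle\ge0$ implies $\langle F(z),z-y\rangle\ge m\|z-y\|^2$. Strong pseudomonotonicity assumption: there are $\gamma>0$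 and $L_F>0$ such that for every $t\in[0,T]$ and every $x\in H$, the operator $F_{t,x}$ is strongly pseudomonotone on $K(t)$ with modulus $\gamma$ and Lipschitz continuous on $H$ with modulus $L_F$. State-Lipschitz assumption: there exists $\alpha_h>0$ such that $\|h(t,x_1,u)-h(t,x_2,u)\|\le\alpha_h\|x_1-x_2\|$ for all $t\in[0,T]$ and all $x_1,x_2,u\in H$. Under the standing and strong pseudomonotonicity assumptions, for each $t\in[0,T]$ and $x\in H$ there is a unique $u\in H$, denoted $u_x(t)$, with $Pu\in K(t)$ and $\langle h(t,x,u)-u,v-Pu\rangle\le0$ for all $v\in K(t)$. *)

theory Defs
  imports "HOL-Analysis.Analysis"
begin

text \<open>
  Separable real Hilbert spaces are modelled by types of sort
  \<open>{real_inner, banach, second_countable_topology}\<close>; for metric spaces,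
  second countability is the same as separability.
\<close>

definition strongly_measurable :: "'s measure \<Rightarrow> ('s \<Rightarrow> 'a::topological_space) \<Rightarrow> bool"
  where "strongly_measurable M g \<longleftrightarrow>
    (\<exists>s. (\<forall>n::nat. simple_function M (s n)) \<and> (AE t in M. (\<lambda>n. s n t) \<longlonglongrightarrow> g t))"

definition caratheodory ::
  "real \<Rightarrow> (real \<Rightarrow> 'x::{metric_space, second_countable_topology} \<Rightarrow> 'a::topological_space) \<Rightarrow> bool"
  where "caratheodory T G \<longleftrightarrow>
    (\<forall>z. strongly_measurable (lebesgue_on {0..T}) (\<lambda>t. G t z)) \<and>
    (AE t in lebesgue_on {0..T}. continuous_on UNIV (G t))"

definition C0_semigroup :: "(real \<Rightarrow> 'a::real_normed_vector \<Rightarrow> 'a) \<Rightarrow> bool"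
  where "C0_semigroup S \<longleftrightarrow>
    (\<forall>t\<ge>0. bounded_linear (S t)) \<and>
    (\<forall>x. S 0 x = x) \<and>
    (\<forall>s\<ge>0. \<forall>t\<ge>0. \<forall>x. S (s + t) x = S s (S t x)) \<and>
    (\<forall>x. ((\<lambda>t. S t x) \<longlongrightarrow> x) (at_right 0))"

text \<open>
  An unbounded operator is given by its domain \<open>D\<close> and a total function \<open>A\<close>, whose values
  outside \<open>D\<close> are irrelevant.
\<close>

definition infinitesimal_generator ::
  "'a set \<Rightarrow> ('a \<Rightarrow> 'a) \<Rightarrow> (real \<Rightarrow> 'a::real_normed_vector \<Rightarrow> 'a) \<Rightarrow> bool"
  where "infinitesimal_generator D A S \<longleftrightarrow>
    D = {x. \<exists>y. ((\<lambda>t. (S t x - x) /\<^sub>R t) \<longlongrightarrow> y) (at_right 0)} \<and>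
    (\<forall>x\<in>D. ((\<lambda>t. (S t x - x) /\<^sub>R t) \<longlongrightarrow> A x) (at_right 0))"

definition self_adjoint :: "('a::real_inner \<Rightarrow> 'a) \<Rightarrow> bool"
  where "self_adjoint P \<longleftrightarrow> (\<forall>x y. P x \<bullet> y = x \<bullet> P y)"

definition coercive :: "('a::real_inner \<Rightarrow> 'a) \<Rightarrow> bool"
  where "coercive P \<longleftrightarrow> (\<exists>c>0. \<forall>x. P x \<bullet> x \<ge> c * (norm x)\<^sup>2)"

definition strongly_pseudomonotone_on :: "'a set \<Rightarrow> real \<Rightarrow> ('a::real_inner \<Rightarrow> 'a) \<Rightarrow> bool"
  where "strongly_pseudomonotone_on C m F \<longleftrightarrow> 0 < m \<and>
    (\<forall>y\<in>C. \<forall>z\<in>C. F y \<bullet> (z - y) \<ge> 0 \<longrightarrow> F z \<bullet> (z - y) \<ge> m * (norm (z - y))\<^sup>2)"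

text \<open>
  \<open>inv P\<close> is the inverse operator: a bounded, self-adjoint, coercive \<open>P\<close> on a Hilbert space
  is bijective.
\<close>

definition F_op ::
  "('a::real_inner \<Rightarrow> 'a) \<Rightarrow> (real \<Rightarrow> 'a \<Rightarrow> 'a \<Rightarrow> 'a) \<Rightarrow> real \<Rightarrow> 'a \<Rightarrow> 'a \<Rightarrow> 'a"
  where "F_op P h t x y = inv P y - h t x (inv P y)"

definition is_VI_solution ::
  "('a::real_inner \<Rightarrow> 'a) \<Rightarrow> (real \<Rightarrow> 'a set) \<Rightarrow> (real \<Rightarrow> 'a \<Rightarrow> 'a \<Rightarrow> 'a) \<Rightarrow> real \<Rightarrow> 'a \<Rightarrow> 'a \<Rightarrow> bool"
  where "is_VI_solution P K h t x u \<longleftrightarrow>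
    P u \<in> K t \<and> (\<forall>v\<in>K t. (h t x u - u) \<bullet> (v - P u) \<le> 0)"

text \<open>
  The solution written \<open>u\<^sub>x(t)\<close> in the mathematics. The description is proper because the
  standing and strong pseudomonotonicity assumptions give existence and uniqueness.
\<close>

definition VI_solution ::
  "('a::real_inner \<Rightarrow> 'a) \<Rightarrow> (real \<Rightarrow> 'a set) \<Rightarrow> (real \<Rightarrow> 'a \<Rightarrow> 'a \<Rightarrow> 'a) \<Rightarrow> 'a \<Rightarrow> real \<Rightarrow> 'a"
  where "VI_solution P K h x t = (THE u. is_VI_solution P K h t x u)"

end

theory Submission
  imports Defs
begin

text \<open>
  With \<open>y\<^sub>i = P u\<^sub>i\<close> the problem is the variational inequality for \<open>F_op P h t x\<^sub>i\<close> on \<open>K t\<close>. Testing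
  the inequality of \<open>y\<^sub>1\<close> with \<open>y\<^sub>2\<close> and conversely, pseudomonotonicity and the state-Lipschitz bound
  give \<open>\<gamma> * norm (y\<^sub>2 - y\<^sub>1) \<le> \<alpha>_h * norm (x\<^sub>1 - x\<^sub>2)\<close>. The work lies in the existence of solutions,
  without which \<^const>\<open>VI_solution\<close> is an arbitrary value. Since the sets to be intersected in the
  KKM argument are convex, Klee's theorem on convex covers replaces Brouwer's fixed point theorem.
\<close>

section \<open>Intersections of convex sets in the manner of Klee and KKM\<close>

text \<open>Compactness supplies a closest pair \<open>a\<close>, \<open>b\<close>, so no
  completeness or finite dimension is required. Each of the two points is the projection of the
  other onto its set, hence the hyperplane through their midpoint with normal \<open>b - a\<close>
  separates strictly.\<close>

lemma compact_convex_separation: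
  fixes A B :: "'a::real_inner set"
  assumes "compact A" "convex A" "A \<noteq> {}" "compact B" "convex B" "B \<noteq> {}" "A \<inter> B = {}"
  obtains w c where "\<And>x. x \<in> A \<Longrightarrow> w \<bullet> x < c" "\<And>x. x \<in> B \<Longrightarrow> c < w \<bullet> x"
proof -
  have "\<exists>p\<in>A \<times> B. \<forall>q\<in>A \<times> B. dist (fst p) (snd p) \<le> dist (fst q) (snd q)"
    using assms by (intro continuous_attains_inf compact_Times continuous_intros) auto
  then obtain a b where ab: "a \<in> A" "b \<in> B"
    and min: "\<And>x y. x \<in> A \<Longrightarrow> y \<in> B \<Longrightarrow> dist a b \<le> dist x y"
    by auto
  have "a \<noteq> b" using ab assms by auto
  then have pos: "(b - a) \<bullet> (b - a) > 0" by simp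
  have A: "(b - a) \<bullet> (x - a) \<le> 0" if "x \<in> A" for x
    using any_closest_point_dot[of A a x b] ab assms that min
    by (auto simp: compact_imp_closed dist_commute)
  have B: "(a - b) \<bullet> (x - b) \<le> 0" if "x \<in> B" for x
    using any_closest_point_dot[of B b x a] ab assms that min
    by (auto simp: compact_imp_closed)
  show thesis
  proof (rule that[of "b - a" "(b - a) \<bullet> (a + b) / 2"])
    fix x assume "x \<in> A"
    then show "(b - a) \<bullet> x < (b - a) \<bullet> (a + b) / 2"
      using A[of x] pos by (simp add: algebra_simps inner_commute)
  next
    fix x assume "x \<in> B"
    then show "(b - a) \<bullet> (a + b) / 2 < (b - a) \<bullet> x"
      using B[OF \<open>x \<in> B\<close>] pos
      unfolding inner_diff_left inner_diff_right inner_add_right inner_commute[of b a] by simp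
  qed
qed

lemma convex_meets_hyperplane:
  fixes S :: "'a::real_inner set"
  assumes "convex S" "x \<in> S" "y \<in> S" "w \<bullet> x < c" "c < w \<bullet> y"
  shows "S \<inter> {z. w \<bullet> z = c} \<noteq> {}"
  using connected_ivt_hyperplane[of S x y w c] assms convex_connected by auto

text \<open>Klee's theorem: if the last set missed the intersection of the others, a separating
  hyperplane would cut the others down to a smaller family with the same properties.\<close>

lemma Klee_intersection:
  fixes M :: "'i \<Rightarrow> 'a::real_inner set"
  assumes "finite I" "\<And>i. i \<in> I \<Longrightarrow> compact (M i)" "\<And>i. i \<in> I \<Longrightarrow> convex (M i)"
    and "convex (\<Union>i\<in>I. M i)" "(\<Union>i\<in>I. M i) \<noteq> {}"
    and "\<And>i. i \<in> I \<Longrightarrow> (\<Inter>j\<in>I - {i}. M j) \<noteq> {}"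
  shows "(\<Inter>i\<in>I. M i) \<noteq> {}"
  using assms
proof (induction I arbitrary: M rule: finite_induct)
  case empty
  then show ?case by simp
next
  case (insert n J M)
  show ?case
  proof (cases "J = {}")
    case True
    then show ?thesis using insert.prems by simp
  next
    case False
    define A where "A = M n"
    define B where "B = (\<Inter>j\<in>J. M j)"
    have J: "insert n J - {n} = J" using insert.hyps by auto
    have B_ne: "B \<noteq> {}" using insert.prems(5)[of n] J by (simp add: B_def)
    obtain i0 where i0: "i0 \<in> J" using False by auto
    have n_mem: "n \<in> insert n J - {i}" if "i \<in> J" for i
      using that insert.hyps by auto
    have A_ne: "A \<noteq> {}"
      using insert.prems(5)[of i0] i0 n_mem[OF i0] by (auto simp: A_def)
    have "closed B"
      unfolding B_def using insert.prems by (intro closed_INT) (auto simp: compact_imp_closed)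
    then have "compact (M i0 \<inter> B)"
      using insert.prems i0 by (intro compact_Int_closed) auto
    moreover have "M i0 \<inter> B = B" using i0 by (auto simp: B_def)
    ultimately have "compact B" by simp
    have "convex B"
      unfolding B_def using insert.prems by (intro convex_INT) auto
    show ?thesis
    proof (rule ccontr)
      assume "\<not> ?thesis"
      then have "A \<inter> B = {}" by (auto simp: A_def B_def)
      then obtain w c where w: "\<And>x. x \<in> A \<Longrightarrow> w \<bullet> x < c" "\<And>x. x \<in> B \<Longrightarrow> c < w \<bullet> x"
        using compact_convex_separation[of A B] \<open>compact B\<close> \<open>convex B\<close> A_ne B_ne insert.prems
        by (auto simp: A_def)
      define N where "N = {z. w \<bullet> z = c}"
      have "closed N" "convex N"
        unfolding N_def by (auto simp: closed_hyperplane convex_hyperplane)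
      obtain b where b: "b \<in> B" using B_ne by auto
      \<comment> \<open>\<open>A\<close> lies strictly below \<open>N\<close>, so cutting with
        \<open>N\<close> loses nothing when \<open>n\<close> is dropped; this keeps the smaller
        union convex.\<close>
      have un: "(\<Union>j\<in>J. M j \<inter> N) = (\<Union>i\<in>insert n J. M i) \<inter> N"
        using w(1) by (force simp: N_def A_def)
      have "(\<Inter>j\<in>J. M j \<inter> N) \<noteq> {}"
      proof (rule insert.IH)
        show "compact (M i \<inter> N)" if "i \<in> J" for i
          using insert.prems that \<open>closed N\<close> by (auto intro: compact_Int_closed)
        show "convex (M i \<inter> N)" if "i \<in> J" for i
          using insert.prems that \<open>convex N\<close> by (auto intro: convex_Int)
        show "convex (\<Union>j\<in>J. M j \<inter> N)"
          unfolding un using insert.prems \<open>convex N\<close> by (intro convex_Int)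
        obtain a where a: "a \<in> A" using A_ne by auto
        have "(\<Union>i\<in>insert n J. M i) \<inter> N \<noteq> {}"
          unfolding N_def
          by (rule convex_meets_hyperplane[of _ a b])
            (use insert.prems a b i0 w in \<open>auto simp: A_def B_def\<close>)
        then show "(\<Union>j\<in>J. M j \<inter> N) \<noteq> {}" unfolding un .
      next
        fix i assume i: "i \<in> J"
        \<comment> \<open>The intersection over \<open>J - {i}\<close> contains this
          \<open>a\<close>, which lies in \<open>A\<close> below the hyperplane, and
          \<open>b\<close>, which lies above it, so by convexity it meets \<open>N\<close>.\<close>
        obtain a where a: "a \<in> (\<Inter>j\<in>insert n J - {i}. M j)" using insert.prems(5)[of i] i by auto
        then have "a \<in> A" using n_mem[OF i] by (auto simp: A_def)
        have "(\<Inter>j\<in>J - {i}. M j) \<inter> N \<noteq> {}"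
          unfolding N_def
        proof (rule convex_meets_hyperplane[of _ a b])
          show "convex (\<Inter>j\<in>J - {i}. M j)" using insert.prems by (intro convex_INT) auto
        qed (use a b \<open>a \<in> A\<close> w in \<open>auto simp: B_def\<close>)
        then show "(\<Inter>j\<in>J - {i}. M j \<inter> N) \<noteq> {}" by auto
      qed
      then obtain z where "z \<in> B" "z \<in> N" using False by (auto simp: B_def)
      then show False using w(2)[of z] by (simp add: N_def)
    qed
  qed
qed

text \<open>Klee's theorem applies to the sets \<open>M z\<close> cut with the hull of
  \<open>Z\<close>: the covering condition for \<open>Z\<close> itself makes their union that hull,
  which is convex, and the induction hypothesis for \<open>Z - {z}\<close> gives the intersections
  with one set omitted.\<close>

lemma convex_KKM:
  fixes M :: "'a::real_inner \<Rightarrow> 'a set"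
  assumes "finite Z" "Z \<noteq> {}" "\<And>z. z \<in> Z \<Longrightarrow> closed (M z)" "\<And>z. z \<in> Z \<Longrightarrow> convex (M z)"
    and "\<And>I. I \<subseteq> Z \<Longrightarrow> convex hull I \<subseteq> (\<Union>z\<in>I. M z)"
  shows "convex hull Z \<inter> (\<Inter>z\<in>Z. M z) \<noteq> {}"
  using assms
proof (induction Z rule: finite_psubset_induct)
  case (psubset Z)
  have un: "(\<Union>z\<in>Z. M z \<inter> convex hull Z) = convex hull Z"
    using psubset.prems(4)[of Z] by auto
  have "(\<Inter>z\<in>Z. M z \<inter> convex hull Z) \<noteq> {}"
  proof (rule Klee_intersection)
    show "compact (M z \<inter> convex hull Z)" if "z \<in> Z" for z
      using that psubset finite_imp_compact_convex_hull[of Z] by (auto intro: closed_Int_compact)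
    show "convex (M z \<inter> convex hull Z)" if "z \<in> Z" for z
      using that psubset by (auto intro: convex_Int)
    show "convex (\<Union>z\<in>Z. M z \<inter> convex hull Z)" unfolding un by simp
    show "(\<Union>z\<in>Z. M z \<inter> convex hull Z) \<noteq> {}" unfolding un using psubset.prems by simp
  next
    fix z assume z: "z \<in> Z"
    show "(\<Inter>j\<in>Z - {z}. M j \<inter> convex hull Z) \<noteq> {}"
    proof (cases "Z - {z} = {}")
      case True
      then show ?thesis by (simp only: image_empty Inter_empty) simp
    next
      case False
      have "convex hull (Z - {z}) \<inter> (\<Inter>j\<in>Z - {z}. M j) \<noteq> {}"
        using z False psubset.prems by (intro psubset.IH) auto
      moreover have "convex hull (Z - {z}) \<subseteq> convex hull Z" by (intro hull_mono) auto
      ultimately show ?thesis by blast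
    qed
  qed (use psubset in auto)
  then show ?case using psubset.prems(1) by blast
qed

section \<open>Finite intersection property for closed convex bounded sets\<close>

text \<open>Replaces weak compactness: finite intersections whose minimal norm is almost the supremum
  of all minimal norms have, by the parallelogram law, almost-minimizers of small diameter.\<close>

lemma closed_convex_bounded_fip:
  fixes M :: "'i \<Rightarrow> 'a::{real_inner, complete_space} set"
  assumes closed: "\<And>i. i \<in> I \<Longrightarrow> closed (M i)" and convex: "\<And>i. i \<in> I \<Longrightarrow> convex (M i)"
    and bdd: "i0 \<in> I" "bounded (M i0)"
    and fip: "\<And>J. finite J \<Longrightarrow> J \<subseteq> I \<Longrightarrow> (\<Inter>j\<in>J. M j) \<noteq> {}"
  shows "(\<Inter>i\<in>I. M i) \<noteq> {}"
proof -
  \<comment> \<open>Inserting \<open>i0\<close> keeps every \<open>X J\<close> inside the bounded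
    set \<open>M i0\<close>, so the minimal norms \<open>d J\<close> have a finite supremum
    \<open>D\<close>.\<close>
  define X where "X J = (\<Inter>j\<in>insert i0 J. M j)" for J
  define fin where "fin = {J. finite J \<and> J \<subseteq> I}"
  define d where "d J = Inf (norm ` X J)" for J
  define D where "D = Sup (d ` fin)"
  define r where "r n = 1 / real (Suc n)" for n
  have X_ne: "X J \<noteq> {}" if "J \<in> fin" for J
    using fip[of "insert i0 J"] bdd that unfolding X_def fin_def by blast
  have X_closed: "closed (X J)" and X_convex: "convex (X J)" if "J \<in> fin" for J
    unfolding X_def using closed convex bdd that
    by (auto simp: fin_def intro!: closed_INT convex_INT closed_Int convex_Int)
  have d_le: "d J \<le> norm x" if "x \<in> X J" for J x
    unfolding d_def using that by (intro cInf_lower bdd_belowI[of _ 0]) auto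
  obtain b where b: "\<And>x. x \<in> M i0 \<Longrightarrow> norm x \<le> b" using bdd(2) bounded_iff by metis
  have bdd_d: "bdd_above (d ` fin)"
  proof (rule bdd_aboveI[of _ b])
    fix u assume "u \<in> d ` fin"
    then obtain J where J: "u = d J" "J \<in> fin" by auto
    then obtain x where x: "x \<in> X J" using X_ne by blast
    then have "norm x \<le> b" using b by (auto simp: X_def)
    then show "u \<le> b" using d_le[OF x] J by simp
  qed
  have D_ge: "d J \<le> D" if "J \<in> fin" for J
    unfolding D_def using that bdd_d by (intro cSup_upper) auto
  have empty: "{} \<in> fin" by (simp add: fin_def)
  have r_pos: "r n > 0" and r_le: "r n \<le> 1" for n by (simp_all add: r_def)
  have "D \<ge> 0"
  proof -
    have "0 \<le> d {}" unfolding d_def using X_ne[OF empty] by (intro cInf_greatest) auto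
    then show ?thesis using D_ge[OF empty] by simp
  qed
  have "\<forall>n. \<exists>J\<in>fin. D - r n < d J"
  proof
    fix n
    have "D - r n < D" using r_pos[of n] by simp
    then have "\<exists>u\<in>d ` fin. D - r n < u"
      using empty bdd_d unfolding D_def by (subst (asm) less_cSup_iff) auto
    then show "\<exists>J\<in>fin. D - r n < d J" by auto
  qed
  then obtain J where J: "\<And>n. J n \<in> fin" "\<And>n. D - r n < d (J n)" by metis
  \<comment> \<open>Accumulating the \<open>J k\<close> makes \<open>S V n\<close> decrease in
    \<open>n\<close>. The extra \<open>V\<close> allows one more index to be imposed at the
    end.\<close>
  define U where "U n = (\<Union>k\<le>n. J k)" for n
  define S where "S V n = X (U n \<union> V) \<inter> cball 0 (D + r n)" for V n
  have U_fin: "U n \<union> V \<in> fin" if "V \<in> fin" for n V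
    using that J(1) by (auto simp: U_def fin_def)
  have X_mono: "X J' \<subseteq> X J" if "J \<subseteq> J'" for J J' using that by (auto simp: X_def)
  have diam: "(dist x y)\<^sup>2 \<le> 16 * r n * (D + 1)" if V: "V \<in> fin" and x: "x \<in> S V n" and y: "y \<in> S V n"
    for V n x y
  proof -
    \<comment> \<open>By convexity the midpoint stays in \<open>X (J n)\<close>, so its norm is at
      least \<open>D - r n\<close>, while \<open>x\<close> and \<open>y\<close> have norm at most
      \<open>D + r n\<close>; the parallelogram law then forces \<open>x\<close> and
      \<open>y\<close> together.\<close>
    define m where "m = (1/2) *\<^sub>R x + (1/2) *\<^sub>R y"
    have "m \<in> X (U n \<union> V)"
      unfolding m_def using X_convex[OF U_fin[OF V, of n]] x y
      by (intro convexD) (auto simp: S_def)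
    moreover have "J n \<subseteq> U n \<union> V" by (auto simp: U_def)
    ultimately have "m \<in> X (J n)" using X_mono by blast
    then have m: "D - r n \<le> norm m" using J(2)[of n] d_le[of m "J n"] by simp
    have xy: "norm x \<le> D + r n" "norm y \<le> D + r n" using x y by (auto simp: S_def)
    then have m': "norm m \<le> D + r n"
      unfolding m_def using norm_triangle_ineq[of "(1/2) *\<^sub>R x" "(1/2) *\<^sub>R y"] by simp
    have "(dist x y)\<^sup>2 = 2 * (norm x)\<^sup>2 + 2 * (norm y)\<^sup>2 - 4 * (norm m)\<^sup>2"
      unfolding m_def dist_norm power2_norm_eq_inner
      by (simp add: algebra_simps inner_commute)
    also have "\<dots> \<le> 2 * (D + r n)\<^sup>2 + 2 * (D + r n)\<^sup>2 - 4 * (norm m)\<^sup>2"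
      using xy by (intro diff_right_mono add_mono mult_left_mono power_mono) auto
    also have "\<dots> = 4 * ((D + r n - norm m) * (D + r n + norm m))"
      by (simp add: power2_eq_square algebra_simps)
    also have "\<dots> \<le> 4 * ((2 * r n) * (2 * (D + 1)))"
      using m m' r_pos[of n] r_le[of n] \<open>D \<ge> 0\<close> by (intro mult_left_mono mult_mono) auto
    finally show ?thesis by (simp add: algebra_simps)
  qed
  have nest: "\<exists>a. \<Inter>(range (S V)) = {a}" if V: "V \<in> fin" for V
  proof (rule decreasing_closed_nest_sing)
    show "closed (S V n)" for n unfolding S_def using X_closed[OF U_fin[OF V]] by auto
    show "S V n \<noteq> {}" for n
    proof -
      \<comment> \<open>No finite intersection has minimal norm above \<open>D\<close>, so each
        contains points of norm below \<open>D + r n\<close>.\<close>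
      have "Inf (norm ` X (U n \<union> V)) < D + r n"
        using D_ge[OF U_fin[OF V, of n]] r_pos[of n] by (simp add: d_def)
      then obtain x where "x \<in> X (U n \<union> V)" "norm x < D + r n"
        using X_ne[OF U_fin[OF V]] by (subst (asm) cInf_less_iff) (auto intro: bdd_belowI[of _ 0])
      then show ?thesis by (auto simp: S_def intro!: exI[of _ x])
    qed
    show "S V n \<subseteq> S V m" if "m \<le> n" for m n
    proof -
      have "U m \<union> V \<subseteq> U n \<union> V" using that by (fastforce simp: U_def)
      moreover have "cball 0 (D + r n) \<subseteq> cball 0 (D + r m)"
        using that by (intro subset_cball) (simp add: r_def frac_le)
      ultimately show ?thesis unfolding S_def by (intro Int_mono X_mono)
    qed
    fix e :: real assume e: "e > 0"
    have "(\<lambda>n. 16 * r n * (D + 1)) \<longlonglongrightarrow> 16 * 0 * (D + 1)"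
      unfolding r_def by (intro tendsto_intros LIMSEQ_Suc lim_1_over_n)
    then have "\<forall>\<^sub>F n in sequentially. 16 * r n * (D + 1) < e\<^sup>2"
      using e by (intro order_tendstoD) auto
    then obtain n where n: "16 * r n * (D + 1) < e\<^sup>2" using eventually_sequentially by auto
    have "dist x y < e" if "x \<in> S V n" "y \<in> S V n" for x y
      using diam[OF V that] n e by (intro power_less_imp_less_base[of _ 2 e]) auto
    then show "\<exists>n. \<forall>x\<in>S V n. \<forall>y\<in>S V n. dist x y < e" by auto
  qed
  obtain a where a: "\<Inter>(range (S {})) = {a}" using nest[OF empty] by auto
  have "a \<in> M i" if "i \<in> I" for i
  proof -
    have "{i} \<in> fin" using that by (simp add: fin_def)
    then obtain a' where a': "\<Inter>(range (S {i})) = {a'}" using nest by blast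
    \<comment> \<open>Imposing \<open>i\<close> can only shrink the limit set; as both limit sets
      are singletons they coincide, which puts \<open>a\<close> into \<open>M i\<close>.\<close>
    have "S {i} n \<subseteq> S {} n" for n using X_mono[of "U n \<union> {}" "U n \<union> {i}"] by (auto simp: S_def)
    then have "\<Inter>(range (S {i})) \<subseteq> \<Inter>(range (S {}))" by blast
    then have "a' = a" using a a' by simp
    moreover have "a' \<in> S {i} 0" using a' by blast
    ultimately show ?thesis by (simp add: S_def X_def)
  qed
  then show ?thesis by blast
qed

section \<open>Existence and stability for strongly pseudomonotone variational inequalities\<close>

text \<open>Test the dual inequality at \<open>y + s *\<^sub>R (v - y)\<close>, divide by
  \<open>s > 0\<close> and let \<open>s\<close> tend to 0; continuity of \<open>F\<close> moves the
  argument of \<open>F\<close> to \<open>y\<close>.\<close>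

lemma Minty_variational_inequality:
  fixes F :: "'a::real_inner \<Rightarrow> 'a"
  assumes "convex C" "y \<in> C" "v \<in> C" "continuous_on UNIV F"
    and dual: "\<And>z. z \<in> C \<Longrightarrow> F z \<bullet> (z - y) \<ge> 0"
  shows "F y \<bullet> (v - y) \<ge> 0"
proof -
  define g where "g s = F (y + s *\<^sub>R (v - y)) \<bullet> (v - y)" for s :: real
  have "continuous_on UNIV g"
    unfolding g_def by (intro continuous_intros continuous_on_compose2[OF assms(4)]) auto
  then have "isCont g 0" by (simp add: continuous_on_eq_continuous_at)
  then have lim: "(g \<longlongrightarrow> g 0) (at_right 0)"
    by (simp add: isCont_def filterlim_at_split)
  have "\<forall>\<^sub>F s in at_right 0. g s \<ge> 0"
  proof (rule eventually_at_rightI[of 0 1])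
    fix s :: real assume s: "s \<in> {0<..<1}"
    have "(1 - s) *\<^sub>R y + s *\<^sub>R v \<in> C" using s assms by (intro convexD) auto
    then have "y + s *\<^sub>R (v - y) \<in> C" by (simp add: algebra_simps)
    from dual[OF this] have "0 \<le> s * g s" by (simp add: g_def)
    then show "g s \<ge> 0" using s by (simp add: zero_le_mult_iff)
  qed auto
  then have "g 0 \<ge> 0" using lim by (intro tendsto_lowerbound[OF lim]) auto
  then show ?thesis by (simp add: g_def)
qed

text \<open>Strong pseudomonotonicity says exactly that the balls \<open>{y. F z \<bullet> (z - y) \<ge> m * (norm (z - y))\<^sup>2}\<close>
  satisfy the KKM covering condition; a common point solves the variational inequality by Minty.\<close>

lemma strongly_pseudomonotone_VI_exists:
  fixes F :: "'a::{real_inner, complete_space} \<Rightarrow> 'a"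
  assumes C: "closed C" "convex C" "C \<noteq> {}"
    and pm: "strongly_pseudomonotone_on C m F" and cont: "continuous_on UNIV F"
  shows "\<exists>y\<in>C. \<forall>v\<in>C. F y \<bullet> (v - y) \<ge> 0"
proof -
  have m: "m > 0" using pm by (simp add: strongly_pseudomonotone_on_def)
  define Q where "Q z = {y. F z \<bullet> (z - y) \<ge> m * (norm (z - y))\<^sup>2}" for z
  \<comment> \<open>Completing the square in \<open>z - y\<close> gives centre and radius;
    closedness, convexity and boundedness are then immediate.\<close>
  have Q: "Q z = cball (z - (1 / (2 * m)) *\<^sub>R F z) (norm (F z) / (2 * m))" for z
  proof -
    have "y \<in> Q z \<longleftrightarrow> dist (z - (1 / (2 * m)) *\<^sub>R F z) y \<le> norm (F z) / (2 * m)" for y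
    proof -
      have "(norm ((z - y) - (1 / (2 * m)) *\<^sub>R F z))\<^sup>2
          = (norm (z - y))\<^sup>2 - (F z \<bullet> (z - y)) / m + (norm (F z) / (2 * m))\<^sup>2"
        using m dot_norm_neg[of "z - y" "(1 / (2 * m)) *\<^sub>R F z"]
        by (simp add: inner_commute power_divide power_mult_distrib field_simps)
      then have "(norm ((z - y) - (1 / (2 * m)) *\<^sub>R F z))\<^sup>2 \<le> (norm (F z) / (2 * m))\<^sup>2
          \<longleftrightarrow> (norm (z - y))\<^sup>2 \<le> (F z \<bullet> (z - y)) / m"
        by simp
      also have "\<dots> \<longleftrightarrow> y \<in> Q z"
        using m by (simp add: Q_def pos_le_divide_eq mult.commute)
      finally have "(norm ((z - y) - (1 / (2 * m)) *\<^sub>R F z))\<^sup>2 \<le> (norm (F z) / (2 * m))\<^sup>2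
          \<longleftrightarrow> y \<in> Q z" .
      then have "norm ((z - y) - (1 / (2 * m)) *\<^sub>R F z) \<le> norm (F z) / (2 * m) \<longleftrightarrow> y \<in> Q z"
        using m by (subst (asm) power_mono_iff) auto
      moreover have "dist (z - (1 / (2 * m)) *\<^sub>R F z) y = norm ((z - y) - (1 / (2 * m)) *\<^sub>R F z)"
        unfolding dist_norm by (rule arg_cong[of _ _ norm]) (simp add: algebra_simps)
      ultimately show ?thesis by simp
    qed
    then show ?thesis unfolding set_eq_iff mem_cball by blast
  qed
  have Q_closed: "closed (Q z)" and Q_convex: "convex (Q z)" and Q_bdd: "bounded (Q z)" for z
    unfolding Q by auto
  have cover: "convex hull J \<subseteq> (\<Union>z\<in>J. Q z)" if J: "J \<subseteq> C" for J
  proof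
    fix y assume y: "y \<in> convex hull J"
    then have "y \<in> C" using J C hull_minimal[of J C] by blast
    show "y \<in> (\<Union>z\<in>J. Q z)"
    proof (rule ccontr)
      assume "y \<notin> (\<Union>z\<in>J. Q z)"
      \<comment> \<open>Contrapositive of pseudomonotonicity. It puts \<open>J\<close>, and hence
        its hull, into an open half-space whose boundary passes through \<open>y\<close>,
        contradicting that \<open>y\<close> lies in the hull.\<close>
      then have "F y \<bullet> (z - y) < 0" if "z \<in> J" for z
        using pm \<open>y \<in> C\<close> J that unfolding strongly_pseudomonotone_on_def Q_def
        by (metis (mono_tags, lifting) UN_I mem_Collect_eq not_le subsetD)
      then have "J \<subseteq> {z. F y \<bullet> z < F y \<bullet> y}" by (auto simp: inner_diff_right)
      then have "convex hull J \<subseteq> {z. F y \<bullet> z < F y \<bullet> y}"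
        by (intro hull_minimal convex_halfspace_lt)
      then show False using y by auto
    qed
  qed
  obtain z0 where z0: "z0 \<in> C" using C by auto
  have "(\<Inter>z\<in>C. C \<inter> Q z) \<noteq> {}"
  proof (rule closed_convex_bounded_fip[OF _ _ z0])
    fix J assume J: "finite J" "J \<subseteq> C"
    show "(\<Inter>z\<in>J. C \<inter> Q z) \<noteq> {}"
    proof (cases "J = {}")
      case False
      have "convex hull J \<inter> (\<Inter>z\<in>J. Q z) \<noteq> {}"
        using J False Q_closed Q_convex
        by (intro convex_KKM cover) (auto dest: finite_subset)
      moreover have "convex hull J \<subseteq> C" using J C hull_minimal by blast
      ultimately show ?thesis by blast
    qed simp
  qed (use C Q_closed Q_convex Q_bdd in \<open>auto intro: convex_Int bounded_subset\<close>)
  then obtain y where y: "y \<in> C" "\<And>z. z \<in> C \<Longrightarrow> y \<in> Q z" using z0 by blast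
  have "F z \<bullet> (z - y) \<ge> 0" if "z \<in> C" for z
  proof -
    have "0 \<le> m * (norm (z - y))\<^sup>2" using m by simp
    also have "\<dots> \<le> F z \<bullet> (z - y)" using y(2)[OF that] by (simp add: Q_def)
    finally show ?thesis .
  qed
  then show ?thesis using Minty_variational_inequality[OF C(2) y(1) _ cont] y(1) by blast
qed

text \<open>Testing the inequality of \<open>y\<close> with \<open>z\<close> triggers
  pseudomonotonicity; testing that of \<open>z\<close> with \<open>y\<close> allows
  \<open>G z\<close> to be subtracted. The case \<open>G = F\<close> yields uniqueness, and two
  states \<open>x1\<close>, \<open>x2\<close> yield the Lipschitz estimate.\<close>

lemma strongly_pseudomonotone_VI_stability:
  fixes F G :: "'a::real_inner \<Rightarrow> 'a"
  assumes pm: "strongly_pseudomonotone_on C m F" and "y \<in> C" "z \<in> C"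
    and y: "\<forall>v\<in>C. F y \<bullet> (v - y) \<ge> 0" and z: "\<forall>v\<in>C. G z \<bullet> (v - z) \<ge> 0"
  shows "m * norm (z - y) \<le> norm (F z - G z)"
proof -
  have "m * (norm (z - y))\<^sup>2 \<le> F z \<bullet> (z - y)"
    using assms by (auto simp: strongly_pseudomonotone_on_def)
  also have "\<dots> \<le> (F z - G z) \<bullet> (z - y)"
    using z \<open>y \<in> C\<close> by (force simp: inner_diff_left inner_diff_right)
  also have "\<dots> \<le> norm (F z - G z) * norm (z - y)" by (rule norm_cauchy_schwarz)
  finally have "norm (z - y) * (m * norm (z - y)) \<le> norm (z - y) * norm (F z - G z)"
    by (simp add: power2_eq_square mult_ac)
  then show ?thesis by (cases "z = y") (simp_all add: mult_le_cancel_left)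
qed

section \<open>Invertibility of bounded coercive operators\<close>

lemma coercive_lower_bound:
  assumes "coercive P"
  obtains c where "c > 0" "\<And>x. c * norm x \<le> norm (P x)"
proof -
  obtain c where c: "c > 0" "\<And>x. P x \<bullet> x \<ge> c * (norm x)\<^sup>2"
    using assms by (auto simp: coercive_def)
  have "c * norm x \<le> norm (P x)" for x
  proof (cases "x = 0")
    case False
    have "c * (norm x)\<^sup>2 \<le> norm (P x) * norm x" using c(2)[of x] norm_cauchy_schwarz[of "P x" x] by simp
    then show ?thesis using False by (simp add: power2_eq_square)
  qed simp
  with c(1) show thesis by (rule that)
qed

text \<open>For small \<open>r\<close> the map \<open>x \<mapsto> x - r (P x - y)\<close> is a contraction, whose fixed point solves \<open>P x = y\<close>.\<close>

lemma coercive_bij: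
  fixes P :: "'a::{real_inner, complete_space} \<Rightarrow> 'a"
  assumes P: "bounded_linear P" and "coercive P"
  shows "bij P"
proof (rule bijI)
  interpret bounded_linear P by (rule P)
  obtain c0 where c0: "c0 > 0" "\<And>x. c0 * norm x \<le> norm (P x)"
    using coercive_lower_bound[OF assms(2)] by blast
  show "inj P"
  proof (rule injI)
    fix x y assume "P x = P y"
    then show "x = y" using c0(2)[of "x - y"] c0(1) by (simp add: diff mult_le_0_iff)
  qed
  obtain c where c: "c > 0" "\<And>x. P x \<bullet> x \<ge> c * (norm x)\<^sup>2"
    using assms by (auto simp: coercive_def)
  obtain B where B: "B > 0" "\<And>x. norm (P x) \<le> norm x * B" using pos_bounded by auto
  \<comment> \<open>Adding \<open>c\<close> ensures \<open>c \<le> b\<close>, hence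
    \<open>q \<ge> 0\<close>. The step \<open>r = c / b\<^sup>2\<close> minimizes the squared
    contraction factor \<open>1 - 2 * r * c + r\<^sup>2 * b\<^sup>2\<close>, with minimum
    \<open>q\<close>.\<close>
  define b where "b = B + c"
  have b: "b > 0" "b \<ge> c" "\<And>x. norm (P x) \<le> b * norm x"
    using B c by (auto simp: b_def algebra_simps intro: add_increasing2)
  define r where "r = c / b\<^sup>2"
  define q where "q = 1 - c\<^sup>2 / b\<^sup>2"
  have r: "r > 0" using b c by (simp add: r_def)
  have q: "0 \<le> q" "q < 1" using b c by (auto simp: q_def field_simps intro: power_mono)
  have rc: "r * c = c\<^sup>2 / b\<^sup>2" "r\<^sup>2 * b\<^sup>2 = c\<^sup>2 / b\<^sup>2"
    using b by (simp_all add: r_def power2_eq_square)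
  have contr: "norm (x - r *\<^sub>R P x) \<le> sqrt q * norm x" for x
  proof -
    have "(norm (x - r *\<^sub>R P x))\<^sup>2 = (norm x)\<^sup>2 - 2 * r * (P x \<bullet> x) + r\<^sup>2 * (norm (P x))\<^sup>2"
      unfolding power2_norm_eq_inner
      by (simp add: inner_diff_left inner_diff_right inner_commute power2_eq_square)
    also have "\<dots> \<le> (norm x)\<^sup>2 - 2 * r * (c * (norm x)\<^sup>2) + r\<^sup>2 * (b * norm x)\<^sup>2"
      using c(2)[of x] b(3)[of x] r by (intro add_mono diff_mono mult_left_mono power_mono) auto
    also have "\<dots> = (1 - 2 * (r * c) + r\<^sup>2 * b\<^sup>2) * (norm x)\<^sup>2"
      by (simp add: power_mult_distrib algebra_simps)
    also have "\<dots> = q * (norm x)\<^sup>2" by (simp add: rc q_def)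
    also have "\<dots> = (sqrt q * norm x)\<^sup>2" using q(1) by (simp add: power_mult_distrib)
    finally have "(norm (x - r *\<^sub>R P x))\<^sup>2 \<le> (sqrt q * norm x)\<^sup>2" .
    moreover have "0 \<le> sqrt q * norm x" using q(1) by simp
    ultimately show ?thesis by (rule power2_le_imp_le)
  qed
  show "surj P"
  proof (rule surjI)
    fix y
    define T where "T x = x - r *\<^sub>R (P x - y)" for x
    have "dist (T x) (T z) \<le> sqrt q * dist x z" for x z
    proof -
      have "T x - T z = (x - z) - r *\<^sub>R P (x - z)" by (simp add: T_def diff algebra_simps)
      then show ?thesis using contr[of "x - z"] by (simp add: dist_norm)
    qed
    then have "\<exists>!x. T x = x" using q by (intro banach_fix_type[of "sqrt q"]) auto
    then obtain x where "T x = x" by auto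
    then have "P x = y" using r by (simp add: T_def)
    then show "P (SOME x. P x = y) = y" by (rule someI)
  qed
qed

text \<open>The coercive lower bound taken at \<open>inv P x\<close> bounds the inverse by
  \<open>1 / c\<close>. Boundedness is what makes \<open>onorm (inv P)\<close> a genuine operator
  norm.\<close>

lemma coercive_bounded_linear_inv:
  fixes P :: "'a::{real_inner, complete_space} \<Rightarrow> 'a"
  assumes P: "bounded_linear P" and "coercive P"
  shows "bounded_linear (inv P)"
proof -
  have bij: "bij P" using coercive_bij[OF assms] .
  obtain c where c: "c > 0" "\<And>x. c * norm x \<le> norm (P x)"
    using coercive_lower_bound[OF assms(2)] by blast
  have lin: "linear (inv P)"
  proof (rule linearI)
    have P_inv: "P (inv P x) = x" for x using bij by (simp add: surj_f_inv_f bij_is_surj)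
    have eqI: "inv P x = y" if "P y = x" for x y
      using that inv_f_f[OF bij_is_inj[OF bij], of y] by simp
    show "inv P (x + y) = inv P x + inv P y" for x y
      by (rule eqI) (simp add: linear_add[OF bounded_linear.linear[OF P]] P_inv)
    show "inv P (k *\<^sub>R x) = k *\<^sub>R inv P x" for k x
      by (rule eqI) (simp add: linear_scale[OF bounded_linear.linear[OF P]] P_inv)
  qed
  have "norm (inv P x) \<le> norm x * (1 / c)" for x
    using c(2)[of "inv P x"] c(1) bij by (simp add: surj_f_inv_f bij_is_surj field_simps)
  then show ?thesis
    using lin by (intro bounded_linear_intro[of _ "1 / c"]) (auto simp: linear_add linear_scale)
qed

section \<open>The solution map and its Lipschitz constant\<close>

lemma is_VI_solution_iff:
  assumes "bij P"
  shows "is_VI_solution P K h t x u \<longleftrightarrow>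
    P u \<in> K t \<and> (\<forall>v\<in>K t. F_op P h t x (P u) \<bullet> (v - P u) \<ge> 0)"
proof -
  have "inv P (P u) = u" using assms by (simp add: bij_is_inj)
  then show ?thesis by (auto simp: is_VI_solution_def F_op_def inner_diff_left)
qed

text \<open>Turns the definite description into a usable solution: existence is transported along
  \<open>y = P u\<close>, and uniqueness is the stability estimate with equal operators.\<close>

lemma is_VI_solution_VI_solution:
  fixes P :: "'a::{real_inner, complete_space} \<Rightarrow> 'a"
  assumes P: "bij P" and K: "closed (K t)" "convex (K t)" "K t \<noteq> {}"
    and pm: "strongly_pseudomonotone_on (K t) m (F_op P h t x)"
    and cont: "continuous_on UNIV (F_op P h t x)"
  shows "is_VI_solution P K h t x (VI_solution P K h x t)"
  unfolding VI_solution_def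
proof (rule theI')
  obtain y where y: "y \<in> K t" "\<forall>v\<in>K t. F_op P h t x y \<bullet> (v - y) \<ge> 0"
    using strongly_pseudomonotone_VI_exists[OF K pm cont] by auto
  show "\<exists>!u. is_VI_solution P K h t x u"
  proof (rule ex1I[of _ "inv P y"])
    show "is_VI_solution P K h t x (inv P y)"
      using y P by (simp add: is_VI_solution_iff surj_f_inv_f bij_is_surj)
  next
    fix u assume "is_VI_solution P K h t x u"
    then have "m * norm (P u - y) \<le> 0"
      using strongly_pseudomonotone_VI_stability[OF pm y(1) _ y(2), of "P u" "F_op P h t x"] P
      by (simp add: is_VI_solution_iff)
    moreover have "m > 0" using pm by (simp add: strongly_pseudomonotone_on_def)
    ultimately have "P u = y" by (simp add: mult_le_0_iff)
    then show "u = inv P y" using inv_f_f[OF bij_is_inj[OF P], of u] by simp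
  qed
qed

theorem proposition3p3:
  fixes T \<gamma> L_F \<alpha>_h :: real
    and D :: "'a::{real_inner, banach, second_countable_topology} set"
    and A :: "'a \<Rightarrow> 'a"
    and S :: "real \<Rightarrow> 'a \<Rightarrow> 'a"
    and P :: "'a \<Rightarrow> 'a"
    and K :: "real \<Rightarrow> 'a set"
    and f h :: "real \<Rightarrow> 'a \<Rightarrow> 'a \<Rightarrow> 'a"
  assumes T_pos: "T > 0"
    and semigroup: "C0_semigroup S"
    and generator: "infinitesimal_generator D A S"
    and P_bounded_linear: "bounded_linear P"
    and P_self_adjoint: "self_adjoint P"
    and P_coercive: "coercive P"
    and K_values: "\<And>t. t \<in> {0..T} \<Longrightarrow> K t \<noteq> {} \<and> closed (K t) \<and> convex (K t)"
    and f_caratheodory: "caratheodory T (\<lambda>t (x, u). f t x u)"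
    and h_caratheodory: "caratheodory T (\<lambda>t (x, u). h t x u)"
    and f_integrable: "integrable (lebesgue_on {0..T}) (\<lambda>t. f t 0 0)"
    and \<gamma>_pos: "\<gamma> > 0"
    and L_F_pos: "L_F > 0"
    and F_pseudomonotone:
      "\<And>t x. t \<in> {0..T} \<Longrightarrow> strongly_pseudomonotone_on (K t) \<gamma> (F_op P h t x)"
    and F_lipschitz: "\<And>t x. t \<in> {0..T} \<Longrightarrow> L_F-lipschitz_on UNIV (F_op P h t x)"
    and \<alpha>_h_pos: "\<alpha>_h > 0"
    and h_state_lipschitz: "\<And>t x1 x2 u. t \<in> {0..T} \<Longrightarrow>
      norm (h t x1 u - h t x2 u) \<le> \<alpha>_h * norm (x1 - x2)"
  shows "\<forall>t\<in>{0..T}. \<forall>x1 x2.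
    norm (VI_solution P K h x1 t - VI_solution P K h x2 t)
      \<le> (\<alpha>_h * onorm (inv P) / \<gamma>) * norm (x1 - x2)"
proof (intro ballI allI)
  fix t x1 x2 assume t: "t \<in> {0..T}"
  have bij: "bij P" using coercive_bij[OF P_bounded_linear P_coercive] .
  have inv: "bounded_linear (inv P)"
    using coercive_bounded_linear_inv[OF P_bounded_linear P_coercive] .
  define u where "u x = VI_solution P K h x t" for x
  have u: "is_VI_solution P K h t x (u x)" for x
    unfolding u_def
  proof (rule is_VI_solution_VI_solution[OF bij])
    show "strongly_pseudomonotone_on (K t) \<gamma> (F_op P h t x)" by (rule F_pseudomonotone[OF t])
    show "continuous_on UNIV (F_op P h t x)"
      by (rule lipschitz_on_continuous_on[OF F_lipschitz[OF t]])
  qed (use K_values[OF t] in auto)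
  have inv_P: "inv P (P v) = v" for v using bij by (simp add: bij_is_inj)
  have "\<gamma> * norm (P (u x2) - P (u x1))
      \<le> norm (F_op P h t x1 (P (u x2)) - F_op P h t x2 (P (u x2)))"
    using u[of x1] u[of x2] unfolding is_VI_solution_iff[OF bij]
    by (intro strongly_pseudomonotone_VI_stability[OF F_pseudomonotone[OF t]]) blast+
  \<comment> \<open>Both operators are evaluated at the same point \<open>P (u x2)\<close>, so the
    \<open>inv P\<close> terms cancel and only the dependence of \<open>h\<close> on the state
    remains.\<close>
  also have "\<dots> = norm (h t x1 (u x2) - h t x2 (u x2))"
    by (simp add: F_op_def inv_P norm_minus_commute)
  also have "\<dots> \<le> \<alpha>_h * norm (x1 - x2)" by (rule h_state_lipschitz[OF t])
  finally have le: "norm (P (u x1) - P (u x2)) \<le> \<alpha>_h * norm (x1 - x2) / \<gamma>"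
    using \<gamma>_pos by (simp add: field_simps norm_minus_commute)
  \<comment> \<open>The estimate so far concerns \<open>P (u x)\<close>; returning to
    \<open>u x\<close> costs the factor \<open>onorm (inv P)\<close>.\<close>
  have "norm (u x1 - u x2) = norm (inv P (P (u x1) - P (u x2)))"
    by (simp add: linear_diff[OF bounded_linear.linear[OF inv]] inv_P)
  also have "\<dots> \<le> onorm (inv P) * norm (P (u x1) - P (u x2))" by (rule onorm[OF inv])
  also have "\<dots> \<le> onorm (inv P) * (\<alpha>_h * norm (x1 - x2) / \<gamma>)"
    by (rule mult_left_mono[OF le onorm_pos_le[OF inv]])
  finally show "norm (VI_solution P K h x1 t - VI_solution P K h x2 t)
      \<le> (\<alpha>_h * onorm (inv P) / \<gamma>) * norm (x1 - x2)"
    by (simp add: u_def mult_ac)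
qed

end
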